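(* Let $\mathbb{F}_q$ be a finite field with $q$ elements, let $d\ge 1$ be an integer, and let $f,g:\mathbb{F}_q^d\to[0,\infty)$ be non-negative functions. For $t\in\mathbb{F}_q$ put $$\nu(t)=\sum_{x,y\in\mathbb{F}_q^d:\ x\cdot y=t} f(x)g(y).$$ Then $\nu(t)=\|f\|_1\|g\|_1q^{-1}+R(t)$, where $$|R(t)|\le \|f\|_2\,\|g\|_2\,q^{\frac{d-1}{2}}\quad\text{for every } t\ne 0.$$ Moreover, if $E=\{x\in\mathbb{F}_q^d: f(x)\neq 0\}$ denotes the support of $f$ and $(0,\dots,0)\notin E$, then $$\sum_{t\in\mathbb{F}_q}\nu^2(t)\le \|f\|_2^2\cdot|E|\cdot\|g\|_1^2\cdot q^{-1}+\|f\|_2^2\cdot q^{2d-1}\sum_{k\in\mathbb{F}_q^d,\ k\ne(0,\dots,0)}|\widehat g(k)|^2\,|E\cap l_k|,$$ where $l_k=\{tk: t\in\mathbb{F}_q^*\}$.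
   Context: $x\cdot y=x_1y_1+\dots+x_dy_d$ is the standard dot product on $\mathbb{F}_q^d$. Norms are with respect to counting measure: $\|f\|_1=\sum_{x\in\mathbb{F}_q^d}|f(x)|$ and $\|f\|_2^2=\sum_{x\in\mathbb{F}_q^d}|f(x)|^2$. Fix a non-trivial additive character $\chi$ of $\mathbb{F}_q$; the Fourier transform is normalized as $\widehat g(k)=q^{-d}\sum_{x\in\mathbb{F}_q^d}\chi(-x\cdot k)g(x)$. $\mathbb{F}_q^*=\mathbb{F}_q\setminus\{0\}$ and $|\cdot|$ of a finite set is its cardinality. *)

theory Defs
  imports "HOL-Analysis.Analysis"
begin

text \<open>
  The field with q elements is a type of sort \<open>{field, finite}\<close>, so q is \<open>CARD('a)\<close>; the space
  of d-dimensional vectors over it is \<open>'a ^ 'd\<close> with \<open>'d\<close> a finite (automatically nonempty)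
  index type and d equal to \<open>CARD('d)\<close>. The dot product is the library's
  \<^const>\<open>scalar_product\<close>.
\<close>

definition l1_norm :: "('b::finite \<Rightarrow> 'c::real_normed_vector) \<Rightarrow> real" where
  "l1_norm f = (\<Sum>x\<in>UNIV. norm (f x))"

definition l2_norm :: "('b::finite \<Rightarrow> 'c::real_normed_vector) \<Rightarrow> real" where
  "l2_norm f = L2_set (\<lambda>x. norm (f x)) UNIV"

text \<open>
  A homomorphism from the additive group of the field to the multiplicative group of
  nonzero complex numbers. As the field is finite, its values are roots of unity.
\<close>

definition additive_character :: "('a::{field, finite} \<Rightarrow> complex) \<Rightarrow> bool" where
  "additive_character \<psi> \<longleftrightarrow>
     (\<forall>a. \<psi> a \<noteq> 0) \<and> (\<forall>a b. \<psi> (a + b) = \<psi> a * \<psi> b)"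

definition nontrivial_additive_character :: "('a::{field, finite} \<Rightarrow> complex) \<Rightarrow> bool" where
  "nontrivial_additive_character \<psi> \<longleftrightarrow> additive_character \<psi> \<and> (\<exists>a. \<psi> a \<noteq> 1)"

definition fourier ::
  "('a::{field, finite} \<Rightarrow> complex) \<Rightarrow> ('a ^ 'd::finite \<Rightarrow> complex) \<Rightarrow> 'a ^ 'd \<Rightarrow> complex" where
  "fourier \<psi> g k =
     (1 / of_nat (CARD('a) ^ CARD('d))) * (\<Sum>x\<in>UNIV. \<psi> (scalar_product (- x) k) * g x)"

definition dot_count ::
  "('a::{field, finite} ^ 'd::finite \<Rightarrow> real) \<Rightarrow> ('a ^ 'd \<Rightarrow> real) \<Rightarrow> 'a \<Rightarrow> real" where
  "dot_count f g t = (\<Sum>(x, y)\<in>{(x, y). scalar_product x y = t}. f x * g y)"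

definition punctured_line :: "'a::{field, finite} ^ 'd::finite \<Rightarrow> ('a ^ 'd) set" where
  "punctured_line k = {t *s k | t. t \<noteq> 0}"

end

theory Submission
  imports Defs
begin

text \<open>
  Both bounds start from \<open>\<nu>(t) = \<Sum>\<^sub>x f(x) G\<^sub>t(x)\<close>, where \<open>G\<^sub>t(x)\<close> is the sum of \<open>g\<close> over
  the hyperplane \<open>x \<cdot> y = t\<close>, and Cauchy--Schwarz in \<open>x\<close>.

  For the first, expanding the indicator of \<open>x \<cdot> y = t\<close> in characters writes the deviation of
  \<open>q G\<^sub>t(x)\<close> from the total mass of \<open>g\<close> as the Fourier transform of a function \<open>H\<close> combining the
  dilates of \<open>g\<close>. By Plancherel its second moment reduces to the correlations
  \<open>B(a) = \<Sum>\<^sub>y g(y / a) g(y)\<close>, \<open>a \<noteq> 0\<close>. For \<open>t \<noteq> 0\<close> the weight of \<open>B(a)\<close> is \<open>q - 1\<close> if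
  \<open>a = 1\<close> and \<open>-1\<close> otherwise, so by positivity of \<open>g\<close> only \<open>a = 1\<close> matters.

  For the second, Plancherel in \<open>t\<close> turns \<open>\<Sum>\<^sub>t G\<^sub>t(x)\<^sup>2\<close> into the sum of \<open>|fourier g|\<^sup>2\<close>
  over the multiples \<open>s x\<close>: the term \<open>s = 0\<close> is the main term, and the others are regrouped by
  \<open>k = s x\<close>.
\<close>

section \<open>Orthogonality and Plancherel\<close>

text \<open>Expanding \<open>|z|^2 = z * cnj z\<close> gives a double sum over \<open>k\<close> and
  \<open>l\<close>, of which orthogonality keeps the diagonal. The kernel \<open>e\<close> is
  abstract so that one proof serves both the field and the vector space.\<close>

lemma plancherel_of_orthogonality:
  fixes e :: "'b \<Rightarrow> 'c \<Rightarrow> complex" and h :: "'c \<Rightarrow> complex"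
  assumes "finite K"
    and orth: "\<And>k l. k \<in> K \<Longrightarrow> l \<in> K \<Longrightarrow>
      (\<Sum>x\<in>X. e x k * cnj (e x l)) = (if k = l then of_real N else 0)"
  shows "(\<Sum>x\<in>X. (norm (\<Sum>k\<in>K. e x k * h k))\<^sup>2) = N * (\<Sum>k\<in>K. (norm (h k))\<^sup>2)"
proof -
  have "complex_of_real (\<Sum>x\<in>X. (norm (\<Sum>k\<in>K. e x k * h k))\<^sup>2)
      = (\<Sum>x\<in>X. \<Sum>k\<in>K. \<Sum>l\<in>K. (h k * cnj (h l)) * (e x k * cnj (e x l)))"
    by (simp add: complex_norm_square sum_product mult_ac del: of_real_power)
  also have "\<dots> = (\<Sum>k\<in>K. \<Sum>x\<in>X. \<Sum>l\<in>K. (h k * cnj (h l)) * (e x k * cnj (e x l)))"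
    by (rule sum.swap)
  also have "\<dots> = (\<Sum>k\<in>K. \<Sum>l\<in>K. \<Sum>x\<in>X. (h k * cnj (h l)) * (e x k * cnj (e x l)))"
    by (intro sum.cong refl sum.swap)
  also have "\<dots> = (\<Sum>k\<in>K. \<Sum>l\<in>K. (h k * cnj (h l)) * (if k = l then of_real N else 0))"
    by (intro sum.cong refl) (simp add: sum_distrib_left[symmetric] orth)
  also have "\<dots> = (\<Sum>k\<in>K. h k * cnj (h k) * of_real N)"
    using \<open>finite K\<close> by (simp add: if_distrib cong: if_cong)
  also have "\<dots> = complex_of_real (N * (\<Sum>k\<in>K. (norm (h k))\<^sup>2))"
    by (simp add: complex_norm_square sum_distrib_left mult_ac del: of_real_power)
  finally show ?thesis
    by (simp only: of_real_eq_iff)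
qed

text \<open>Translation by \<open>c\<close> permutes the group and multiplies the sum by
  \<open>\<phi> c\<close>, which differs from 1.\<close>

lemma sum_hom_eq_0:
  fixes \<phi> :: "'b::{ab_group_add, finite} \<Rightarrow> complex"
  assumes hom: "\<And>a b. \<phi> (a + b) = \<phi> a * \<phi> b" and "\<phi> c \<noteq> 1"
  shows "(\<Sum>a\<in>UNIV. \<phi> a) = 0"
proof -
  have "(\<Sum>a\<in>UNIV. \<phi> a) = (\<Sum>a\<in>UNIV. \<phi> (c + a))"
    by (rule sum.reindex_bij_witness[of _ "\<lambda>a. c + a" "\<lambda>a. - c + a"]) auto
  also have "\<dots> = \<phi> c * (\<Sum>a\<in>UNIV. \<phi> a)"
    by (simp add: hom sum_distrib_left)
  finally show ?thesis
    using \<open>\<phi> c \<noteq> 1\<close> by simp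
qed

section \<open>Algebra of the dot product\<close>

lemma scalar_product_add_left:
  fixes x y z :: "'a::comm_ring_1 ^ 'd::finite"
  shows "scalar_product (x + y) z = scalar_product x z + scalar_product y z"
  by (simp add: scalar_product_def distrib_right sum.distrib)

lemma scalar_product_diff_right:
  fixes x y z :: "'a::comm_ring_1 ^ 'd::finite"
  shows "scalar_product x (y - z) = scalar_product x y - scalar_product x z"
  by (simp add: scalar_product_def right_diff_distrib sum_subtractf)

lemma scalar_product_scale_right:
  fixes x y :: "'a::comm_ring_1 ^ 'd::finite"
  shows "scalar_product x (s *s y) = s * scalar_product x y"
  by (simp add: scalar_product_def sum_distrib_left mult_ac)

lemma scalar_product_minus_left:
  fixes x y :: "'a::comm_ring_1 ^ 'd::finite"
  shows "scalar_product (- x) y = - scalar_product x y"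
  by (simp add: scalar_product_def sum_negf)

lemma scalar_product_minus_right:
  fixes x y :: "'a::comm_ring_1 ^ 'd::finite"
  shows "scalar_product x (- y) = - scalar_product x y"
  by (simp add: scalar_product_def sum_negf)

lemma scalar_product_commute:
  fixes x y :: "'a::comm_ring_1 ^ 'd::finite"
  shows "scalar_product x y = scalar_product y x"
  by (simp add: scalar_product_def mult.commute)

section \<open>Additive characters of a finite field\<close>

locale character =
  fixes \<psi> :: "'a::{field, finite} \<Rightarrow> complex"
  assumes nontrivial: "nontrivial_additive_character \<psi>"
begin

lemma add: "\<psi> (a + b) = \<psi> a * \<psi> b"
  and nonzero: "\<psi> a \<noteq> 0"
  using nontrivial by (auto simp: nontrivial_additive_character_def additive_character_def)

lemma zero [simp]: "\<psi> 0 = 1"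
  using add[of 0 0] nonzero[of 0] by simp

lemma diff: "\<psi> (a - b) = \<psi> a * \<psi> (- b)"
  using add[of a "- b"] by simp

text \<open>The bound comes from finiteness: at a point \<open>b\<close> where the modulus is
  maximal, multiplying by \<open>\<psi> a\<close> gives the value at \<open>b + a\<close>, which is
  no larger.\<close>

lemma norm_le_1: "norm (\<psi> a) \<le> 1"
proof -
  let ?N = "range (\<lambda>a. norm (\<psi> a))"
  have "Max ?N \<in> ?N"
    by (rule Max_in) auto
  then obtain b where b: "Max ?N = norm (\<psi> b)"
    by (rule imageE)
  have "norm (\<psi> b) * norm (\<psi> a) = norm (\<psi> (b + a))"
    by (simp add: add norm_mult)
  also have "\<dots> \<le> norm (\<psi> b)"
    unfolding b[symmetric] by (rule Max_ge) auto
  finally show ?thesis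
    using nonzero[of b] by (simp add: mult_le_cancel_left1)
qed

text \<open>The values at \<open>a\<close> and \<open>- a\<close> have product 1, and neither
  exceeds 1 in modulus.\<close>

lemma norm_eq_1: "norm (\<psi> a) = 1"
proof -
  have "norm (\<psi> a) * norm (\<psi> (- a)) = 1"
    by (simp add: add[symmetric] norm_mult[symmetric])
  moreover have "norm (\<psi> a) * norm (\<psi> (- a)) \<le> norm (\<psi> a)"
    using norm_le_1[of "- a"] by (simp add: mult_left_le)
  ultimately show ?thesis
    using norm_le_1[of a] by simp
qed

lemma cnj_eq: "cnj (\<psi> a) = \<psi> (- a)"
proof -
  have "\<psi> a * cnj (\<psi> a) = 1"
    using complex_norm_square[of "\<psi> a"] by (simp add: norm_eq_1)
  moreover have "\<psi> a * \<psi> (- a) = 1"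
    by (simp add: add[symmetric])
  ultimately show ?thesis
    using nonzero[of a] by (metis mult_left_cancel)
qed

text \<open>For \<open>a \<noteq> 0\<close> the homomorphism sending \<open>s\<close> to
  \<open>\<psi> (s * a)\<close> takes the value \<open>\<psi> c \<noteq> 1\<close> at
  \<open>c / a\<close>. The sum thus detects \<open>a = 0\<close>.\<close>

lemma sum_scaled: "(\<Sum>s\<in>UNIV. \<psi> (s * a)) = (if a = 0 then of_nat CARD('a) else 0)"
proof (cases "a = 0")
  case False
  obtain c where "\<psi> c \<noteq> 1"
    using nontrivial by (auto simp: nontrivial_additive_character_def)
  with False have "\<psi> ((c / a) * a) \<noteq> 1"
    by simp
  with False show ?thesis
    by (simp add: sum_hom_eq_0[of "\<lambda>s. \<psi> (s * a)" "c / a"] distrib_right add)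
qed simp

lemma sum_scalar_product:
  fixes k :: "'a ^ 'd::finite"
  shows "(\<Sum>x\<in>UNIV. \<psi> (scalar_product x k)) = (if k = 0 then of_nat (CARD('a) ^ CARD('d)) else 0)"
proof (cases "k = 0")
  case True
  then show ?thesis
    by (simp add: scalar_product_def)
next
  case False
  then obtain i where i: "k $ i \<noteq> 0"
    by (auto simp: vec_eq_iff)
  obtain c where c: "\<psi> c \<noteq> 1"
    using nontrivial by (auto simp: nontrivial_additive_character_def)
  \<comment> \<open>A multiple of a basis vector is chosen to have dot product \<open>c\<close> with
    \<open>k\<close>, so that the homomorphism is nontrivial.\<close>
  have "scalar_product (axis i (c / k $ i)) k = (\<Sum>j\<in>UNIV. if j = i then c else 0)"
    unfolding scalar_product_def by (intro sum.cong) (auto simp: axis_def i)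
  then have "\<psi> (scalar_product (axis i (c / k $ i)) k) \<noteq> 1"
    using c by simp
  with False show ?thesis
    by (simp add: sum_hom_eq_0[of "\<lambda>x. \<psi> (scalar_product x k)"] scalar_product_add_left add)
qed

lemma plancherel_field:
  "(\<Sum>s\<in>UNIV. (norm (\<Sum>t\<in>UNIV. \<psi> (s * t) * h t))\<^sup>2) = real CARD('a) * (\<Sum>t\<in>UNIV. (norm (h t))\<^sup>2)"
proof (rule plancherel_of_orthogonality)
  fix t u :: 'a
  have "(\<Sum>s\<in>UNIV. \<psi> (s * t) * cnj (\<psi> (s * u))) = (\<Sum>s\<in>UNIV. \<psi> (s * (t - u)))"
    by (simp add: cnj_eq add[symmetric] right_diff_distrib)
  then show "(\<Sum>s\<in>UNIV. \<psi> (s * t) * cnj (\<psi> (s * u))) = (if t = u then of_real (real CARD('a)) else 0)"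
    by (simp add: sum_scaled)
qed simp

lemma plancherel_space:
  fixes h :: "'a ^ 'd::finite \<Rightarrow> complex"
  shows "(\<Sum>x\<in>UNIV. (norm (\<Sum>k\<in>UNIV. \<psi> (scalar_product x k) * h k))\<^sup>2)
    = real CARD('a) ^ CARD('d) * (\<Sum>k\<in>UNIV. (norm (h k))\<^sup>2)"
proof (rule plancherel_of_orthogonality)
  fix k l :: "'a ^ 'd"
  have "(\<Sum>x\<in>UNIV. \<psi> (scalar_product x k) * cnj (\<psi> (scalar_product x l)))
      = (\<Sum>x\<in>UNIV. \<psi> (scalar_product x (k - l)))"
    by (simp add: cnj_eq add[symmetric] scalar_product_diff_right)
  then show "(\<Sum>x\<in>UNIV. \<psi> (scalar_product x k) * cnj (\<psi> (scalar_product x l)))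
      = (if k = l then of_real (real CARD('a) ^ CARD('d)) else 0)"
    by (simp add: sum_scalar_product)
qed simp

end

section \<open>Sums over hyperplanes\<close>

text \<open>For \<open>x \<noteq> 0\<close> this is the finite Radon transform of \<open>g\<close>;
  for \<open>x = 0\<close> the index set is the whole space if \<open>t = 0\<close> and empty
  otherwise.\<close>

definition hyperplane_sum ::
  "('a::{field, finite} ^ 'd::finite \<Rightarrow> real) \<Rightarrow> 'a \<Rightarrow> 'a ^ 'd \<Rightarrow> real" where
  "hyperplane_sum g t x = (\<Sum>y | scalar_product x y = t. g y)"

lemma dot_count_eq: "dot_count f g t = (\<Sum>x\<in>UNIV. f x * hyperplane_sum g t x)"
proof -
  have "dot_count f g t = (\<Sum>(x, y)\<in>Sigma UNIV (\<lambda>x. {y. scalar_product x y = t}). f x * g y)"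
    unfolding dot_count_def by (rule sum.cong) auto
  also have "\<dots> = (\<Sum>x\<in>UNIV. \<Sum>y | scalar_product x y = t. f x * g y)"
    by (rule sum.Sigma[symmetric]) auto
  finally show ?thesis
    by (simp add: hyperplane_sum_def sum_distrib_left)
qed

lemma l2_norm_square: "(l2_norm f)\<^sup>2 = (\<Sum>x\<in>UNIV. (norm (f x))\<^sup>2)"
  by (simp add: l2_norm_def L2_set_def sum_nonneg)

lemma scale_reindex:
  fixes F :: "'a::{field, finite} ^ 'd::finite \<Rightarrow> 'b::comm_monoid_add"
  assumes "s \<noteq> 0"
  shows "(\<Sum>y\<in>UNIV. F (s *s y)) = (\<Sum>y\<in>UNIV. F y)"
  by (rule sum.reindex_bij_witness[of _ "\<lambda>y. inverse s *s y" "\<lambda>y. s *s y"])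
    (auto simp: vector_smult_assoc assms)

section \<open>Fourier expansion and the bound for nonzero \<open>t\<close>\<close>

context character
begin

text \<open>Grouping the vectors \<open>y\<close> by the value of their dot product with
  \<open>x\<close>: a Fourier slice identity, relating the transform in \<open>t\<close> to that of
  \<open>g\<close> on the line through \<open>x\<close>.\<close>

lemma hyperplane_sum_transform:
  fixes g :: "'a ^ 'd::finite \<Rightarrow> real"
  shows "(\<Sum>t\<in>UNIV. \<psi> (s * t) * of_real (hyperplane_sum g t x))
    = (\<Sum>y\<in>UNIV. \<psi> (s * scalar_product x y) * of_real (g y))"
proof -
  have "(\<Sum>t\<in>UNIV. \<psi> (s * t) * of_real (hyperplane_sum g t x))
      = (\<Sum>t\<in>UNIV. \<Sum>y | y \<in> UNIV \<and> scalar_product x y = t. \<psi> (s * scalar_product x y) * of_real (g y))"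
    by (auto simp: hyperplane_sum_def sum_distrib_left intro!: sum.cong)
  also have "\<dots> = (\<Sum>y\<in>UNIV. \<psi> (s * scalar_product x y) * of_real (g y))"
    by (rule sum.group) auto
  finally show ?thesis .
qed

text \<open>Summing over all frequencies \<open>s\<close> gives \<open>q\<close> times the indicator
  of the hyperplane; the frequency \<open>s = 0\<close> contributes the total mass of
  \<open>g\<close>, which is subtracted on the left.\<close>

lemma hyperplane_deviation:
  fixes g :: "'a ^ 'd::finite \<Rightarrow> real"
  shows "complex_of_real (real CARD('a) * hyperplane_sum g t x - (\<Sum>y\<in>UNIV. g y))
    = (\<Sum>y\<in>UNIV. \<Sum>s\<in>UNIV - {0}. \<psi> (s * (scalar_product x y - t)) * of_real (g y))"
proof -
  have "complex_of_real (real CARD('a) * hyperplane_sum g t x)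
      = (\<Sum>y\<in>UNIV. (if scalar_product x y - t = 0 then of_nat CARD('a) else 0) * of_real (g y))"
    unfolding hyperplane_sum_def
    by (simp add: sum_distrib_left sum.inter_filter[symmetric] if_distrib if_distribR cong: if_cong)
  also have "\<dots> = (\<Sum>y\<in>UNIV. \<Sum>s\<in>UNIV. \<psi> (s * (scalar_product x y - t)) * of_real (g y))"
    by (simp only: sum_scaled[symmetric] sum_distrib_right)
  also have "\<dots> = (\<Sum>y\<in>UNIV. of_real (g y)
      + (\<Sum>s\<in>UNIV - {0}. \<psi> (s * (scalar_product x y - t)) * of_real (g y)))"
    by (intro sum.cong refl) (subst sum.remove[of _ 0], auto)
  finally show ?thesis
    by (simp add: sum.distrib)
qed

text \<open>The square expands into correlations of dilates of \<open>g\<close>, which depend only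
  on the ratio \<open>a\<close> of the two dilations. Since \<open>t \<noteq> 0\<close>, only
  \<open>a = 1\<close> gets a positive weight; at \<open>t = 0\<close> every weight would be
  \<open>q - 1\<close>.\<close>

lemma sum_dilation_weights:
  fixes g :: "'a ^ 'd::finite \<Rightarrow> real"
  assumes "\<And>x. g x \<ge> 0" and "t \<noteq> 0"
  shows "(\<Sum>k\<in>UNIV. (norm (\<Sum>s\<in>UNIV - {0}. \<psi> (- (s * t)) * of_real (g (inverse s *s k))))\<^sup>2)
    \<le> real CARD('a) * (\<Sum>x\<in>UNIV. (g x)\<^sup>2)"
proof -
  let ?S = "UNIV - {0 :: 'a}"
  define B where "B a = (\<Sum>y\<in>UNIV. g (inverse a *s y) * g y)" for a
  \<comment> \<open>Rescaling \<open>k\<close> by \<open>u\<close> removes the common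
    dilation.\<close>
  have B: "(\<Sum>k\<in>UNIV. g (inverse (a * u) *s k) * g (inverse u *s k)) = B a" if "u \<noteq> 0" for a u
    using scale_reindex[of "inverse u" "\<lambda>y. g (inverse a *s y) * g y"] that
    by (simp add: B_def vector_smult_assoc)
  have B_nonneg: "B a \<ge> 0" for a
    unfolding B_def by (intro sum_nonneg mult_nonneg_nonneg assms)
  \<comment> \<open>The \<open>- 1\<close> is the missing term \<open>u = 0\<close> of the full
    character sum.\<close>
  have char_sum: "(\<Sum>u\<in>?S. \<psi> (u * ((1 - a) * t))) = (if a = 1 then of_nat CARD('a) else 0) - 1" for a
    using sum_scaled[of "(1 - a) * t"] \<open>t \<noteq> 0\<close> by (simp add: sum_diff1)
  have "complex_of_real (\<Sum>k\<in>UNIV. (norm (\<Sum>s\<in>?S. \<psi> (- (s * t)) * of_real (g (inverse s *s k))))\<^sup>2)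
      = (\<Sum>k\<in>UNIV. \<Sum>u\<in>?S. \<Sum>s\<in>?S. \<psi> ((u - s) * t) * of_real (g (inverse s *s k) * g (inverse u *s k)))"
    unfolding of_real_sum complex_norm_square cnj_sum sum_product
    by (rule sum.cong[OF refl], subst sum.swap, intro sum.cong refl)
      (simp add: cnj_eq left_diff_distrib right_diff_distrib diff mult_ac)
  also have "\<dots> = (\<Sum>u\<in>?S. \<Sum>k\<in>UNIV. \<Sum>s\<in>?S. \<psi> ((u - s) * t) * of_real (g (inverse s *s k) * g (inverse u *s k)))"
    by (rule sum.swap)
  also have "\<dots> = (\<Sum>u\<in>?S. \<Sum>s\<in>?S. \<Sum>k\<in>UNIV. \<psi> ((u - s) * t) * of_real (g (inverse s *s k) * g (inverse u *s k)))"
    by (intro sum.cong refl sum.swap)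
  \<comment> \<open>Substituting \<open>s = a * u\<close> separates the ratio \<open>a\<close> from
    \<open>u\<close>.\<close>
  also have "\<dots> = (\<Sum>u\<in>?S. \<Sum>a\<in>?S. \<Sum>k\<in>UNIV. \<psi> ((u - a * u) * t) * of_real (g (inverse (a * u) *s k) * g (inverse u *s k)))"
  proof (rule sum.cong[OF refl])
    fix u assume "u \<in> ?S"
    then show "(\<Sum>s\<in>?S. \<Sum>k\<in>UNIV. \<psi> ((u - s) * t) * of_real (g (inverse s *s k) * g (inverse u *s k)))
      = (\<Sum>a\<in>?S. \<Sum>k\<in>UNIV. \<psi> ((u - a * u) * t) * of_real (g (inverse (a * u) *s k) * g (inverse u *s k)))"
      by (intro sum.reindex_bij_witness[of _ "\<lambda>a. a * u" "\<lambda>s. s / u"]) auto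
  qed
  also have "\<dots> = (\<Sum>u\<in>?S. \<Sum>a\<in>?S. \<psi> ((u - a * u) * t) * of_real (B a))"
    by (intro sum.cong refl) (simp add: B[symmetric] sum_distrib_left)
  also have "\<dots> = (\<Sum>a\<in>?S. \<Sum>u\<in>?S. \<psi> (u * ((1 - a) * t)) * of_real (B a))"
    by (subst sum.swap) (simp add: algebra_simps)
  also have "\<dots> = (\<Sum>a\<in>?S. ((if a = 1 then of_nat CARD('a) else 0) - 1) * of_real (B a))"
    by (simp add: sum_distrib_right[symmetric] char_sum)
  also have "\<dots> = complex_of_real (\<Sum>a\<in>?S. ((if a = 1 then real CARD('a) else 0) - 1) * B a)"
    unfolding of_real_sum by (intro sum.cong refl) simp
  finally have "(\<Sum>k\<in>UNIV. (norm (\<Sum>s\<in>?S. \<psi> (- (s * t)) * of_real (g (inverse s *s k))))\<^sup>2)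
      = (\<Sum>a\<in>?S. ((if a = 1 then real CARD('a) else 0) - 1) * B a)"
    by (simp only: of_real_eq_iff)
  \<comment> \<open>Every term with \<open>a \<noteq> 1\<close> is \<open>- B a \<le> 0\<close>, and
    \<open>q - 1\<close> is rounded up to \<open>q\<close>.\<close>
  also have "\<dots> \<le> (\<Sum>a\<in>?S. if a = 1 then real CARD('a) * B 1 else 0)"
    by (intro sum_mono) (simp add: B_nonneg left_diff_distrib)
  also have "\<dots> = real CARD('a) * (\<Sum>x\<in>UNIV. (g x)\<^sup>2)"
    by (simp add: B_def power2_eq_square)
  finally show ?thesis .
qed

text \<open>Plancherel in \<open>x\<close> applies once the deviation is written as the transform of
  a single function \<open>H\<close>.\<close>

lemma hyperplane_variance:
  fixes g :: "'a ^ 'd::finite \<Rightarrow> real"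
  assumes "\<And>x. g x \<ge> 0" and "t \<noteq> 0"
  shows "(\<Sum>x\<in>UNIV. (hyperplane_sum g t x - (\<Sum>y\<in>UNIV. g y) / real CARD('a))\<^sup>2)
    \<le> real CARD('a) ^ (CARD('d) - 1) * (\<Sum>x\<in>UNIV. (g x)\<^sup>2)"
proof -
  let ?S = "UNIV - {0 :: 'a}"
  define q where "q = real CARD('a)"
  have q: "q > 0"
    by (simp add: q_def)
  define H where "H k = (\<Sum>s\<in>?S. \<psi> (- (s * t)) * of_real (g (inverse s *s k)))" for k
  have deviation: "complex_of_real (q * hyperplane_sum g t x - (\<Sum>y\<in>UNIV. g y))
      = (\<Sum>k\<in>UNIV. \<psi> (scalar_product x k) * H k)" for x
  proof -
    have "complex_of_real (q * hyperplane_sum g t x - (\<Sum>y\<in>UNIV. g y))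
      = (\<Sum>s\<in>?S. \<Sum>y\<in>UNIV. \<psi> (s * (scalar_product x y - t)) * of_real (g y))"
      unfolding q_def hyperplane_deviation by (rule sum.swap)
    \<comment> \<open>Substituting \<open>k = s *s y\<close> moves the frequency \<open>s\<close>
      from the character to the argument of \<open>g\<close>.\<close>
    also have "\<dots> = (\<Sum>s\<in>?S. \<Sum>k\<in>UNIV. \<psi> (scalar_product x k) * (\<psi> (- (s * t)) * of_real (g (inverse s *s k))))"
    proof (rule sum.cong[OF refl])
      fix s assume "s \<in> ?S"
      then show "(\<Sum>y\<in>UNIV. \<psi> (s * (scalar_product x y - t)) * of_real (g y))
        = (\<Sum>k\<in>UNIV. \<psi> (scalar_product x k) * (\<psi> (- (s * t)) * of_real (g (inverse s *s k))))"
        by (subst (2) scale_reindex[of s, symmetric])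
          (auto simp: vector_smult_assoc scalar_product_scale_right right_diff_distrib
            diff mult.assoc)
    qed
    also have "\<dots> = (\<Sum>k\<in>UNIV. \<psi> (scalar_product x k) * H k)"
      by (subst sum.swap) (simp add: H_def sum_distrib_left)
    finally show ?thesis .
  qed
  have "q\<^sup>2 * (\<Sum>x\<in>UNIV. (hyperplane_sum g t x - (\<Sum>y\<in>UNIV. g y) / q)\<^sup>2)
      = (\<Sum>x\<in>UNIV. (norm (complex_of_real (q * hyperplane_sum g t x - (\<Sum>y\<in>UNIV. g y))))\<^sup>2)"
    unfolding norm_of_real power2_abs sum_distrib_left power_mult_distrib[symmetric]
    using q by (simp add: right_diff_distrib)
  also have "\<dots> = q ^ CARD('d) * (\<Sum>k\<in>UNIV. (norm (H k))\<^sup>2)"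
    unfolding deviation plancherel_space by (simp add: q_def)
  also have "\<dots> \<le> q ^ CARD('d) * (q * (\<Sum>x\<in>UNIV. (g x)\<^sup>2))"
    unfolding H_def q_def by (intro mult_left_mono sum_dilation_weights assms) auto
  \<comment> \<open>The truncated subtraction is exact because the index type is nonempty.\<close>
  also have "\<dots> = q\<^sup>2 * (q ^ (CARD('d) - 1) * (\<Sum>x\<in>UNIV. (g x)\<^sup>2))"
    using power_Suc[of q "CARD('d) - 1"] by (simp add: power2_eq_square)
  finally show ?thesis
    using q by (simp add: q_def)
qed

text \<open>By nonnegativity the L1 norms are plain sums, so subtracting the main term replaces each
  hyperplane sum by its deviation from the mean; Cauchy-Schwarz then pairs it with
  \<open>f\<close>.\<close>

lemma dot_count_deviation:
  fixes f g :: "'a ^ 'd::finite \<Rightarrow> real"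
  assumes f: "\<And>x. f x \<ge> 0" and g: "\<And>x. g x \<ge> 0" and "t \<noteq> 0"
  shows "\<bar>dot_count f g t - l1_norm f * l1_norm g / real CARD('a)\<bar>
    \<le> l2_norm f * l2_norm g * real CARD('a) powr ((real CARD('d) - 1) / 2)"
proof (rule power2_le_imp_le)
  define q where "q = real CARD('a)"
  have q: "q > 0"
    by (simp add: q_def)
  have "dot_count f g t - l1_norm f * l1_norm g / q
      = (\<Sum>x\<in>UNIV. f x * (hyperplane_sum g t x - (\<Sum>y\<in>UNIV. g y) / q))"
    using f g by (simp add: dot_count_eq l1_norm_def right_diff_distrib sum_subtractf
      sum_distrib_right[symmetric] sum_divide_distrib[symmetric])
  then have "\<bar>dot_count f g t - l1_norm f * l1_norm g / q\<bar>\<^sup>2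
      \<le> (\<Sum>x\<in>UNIV. (f x)\<^sup>2) * (\<Sum>x\<in>UNIV. (hyperplane_sum g t x - (\<Sum>y\<in>UNIV. g y) / q)\<^sup>2)"
    by (simp add: Cauchy_Schwarz_ineq_sum)
  also have "\<dots> \<le> (\<Sum>x\<in>UNIV. (f x)\<^sup>2) * (q ^ (CARD('d) - 1) * (\<Sum>x\<in>UNIV. (g x)\<^sup>2))"
    unfolding q_def using assms by (intro mult_left_mono hyperplane_variance sum_nonneg) auto
  also have "\<dots> = (l2_norm f * l2_norm g * q powr ((real CARD('d) - 1) / 2))\<^sup>2"
  proof -
    have "(q powr ((real CARD('d) - 1) / 2))\<^sup>2 = q powr (real (CARD('d) - 1))"
      using q by (simp add: powr_power of_nat_diff Suc_leI diff_divide_distrib)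
    also have "\<dots> = q ^ (CARD('d) - 1)"
      using q by (rule powr_realpow)
    finally show ?thesis
      by (simp add: power_mult_distrib l2_norm_square)
  qed
  finally show "\<bar>dot_count f g t - l1_norm f * l1_norm g / real CARD('a)\<bar>\<^sup>2
      \<le> (l2_norm f * l2_norm g * real CARD('a) powr ((real CARD('d) - 1) / 2))\<^sup>2"
    by (simp add: q_def)
qed (simp add: l2_norm_def)

section \<open>The second moment\<close>

text \<open>Plancherel in \<open>t\<close> costs a factor \<open>q\<close> on the left, and the
  normalization of \<open>fourier\<close> gives \<open>q^(2d)\<close> on the right; hence the
  exponent \<open>2d - 1\<close>.\<close>

lemma sum_hyperplane_sum_square:
  fixes g :: "'a ^ 'd::finite \<Rightarrow> real"
  shows "(\<Sum>t\<in>UNIV. (hyperplane_sum g t x)\<^sup>2)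
    = real CARD('a) ^ (2 * CARD('d) - 1) * (\<Sum>s\<in>UNIV. (norm (fourier \<psi> (\<lambda>x. of_real (g x)) (s *s x)))\<^sup>2)"
proof -
  define q where "q = real CARD('a)"
  have q: "q > 0"
    by (simp add: q_def)
  let ?g = "\<lambda>x. complex_of_real (g x)"
  have transform: "(\<Sum>y\<in>UNIV. \<psi> (s * scalar_product x y) * ?g y)
      = of_real (q ^ CARD('d)) * fourier \<psi> ?g (- s *s x)" for s
    by (simp add: fourier_def q_def scalar_product_minus_left scalar_product_scale_right
        scalar_product_commute[of x] scalar_product_minus_right)
  have "q * (\<Sum>t\<in>UNIV. (hyperplane_sum g t x)\<^sup>2)
      = (\<Sum>s\<in>UNIV. (norm (\<Sum>y\<in>UNIV. \<psi> (s * scalar_product x y) * ?g y))\<^sup>2)"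
    using plancherel_field[of "\<lambda>t. of_real (hyperplane_sum g t x)"]
    by (simp add: q_def hyperplane_sum_transform)
  also have "\<dots> = (q ^ CARD('d))\<^sup>2 * (\<Sum>s\<in>UNIV. (norm (fourier \<psi> ?g (- s *s x)))\<^sup>2)"
    unfolding transform using q by (simp add: norm_mult norm_power power_mult_distrib sum_distrib_left)
  \<comment> \<open>The sign in the kernel of \<open>fourier\<close> is absorbed by the symmetry of
    the scalars under negation.\<close>
  also have "(\<Sum>s\<in>UNIV. (norm (fourier \<psi> ?g (- s *s x)))\<^sup>2) = (\<Sum>s\<in>UNIV. (norm (fourier \<psi> ?g (s *s x)))\<^sup>2)"
    by (rule sum.reindex_bij_witness[of _ uminus uminus]) auto
  also have "(q ^ CARD('d))\<^sup>2 = q * q ^ (2 * CARD('d) - 1)"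
    using power_Suc[of q "2 * CARD('d) - 1"] by (simp add: power_mult[symmetric] mult.commute)
  finally show ?thesis
    using q by (simp add: q_def)
qed

end

text \<open>For \<open>x \<noteq> 0\<close> the multiples \<open>s *s x\<close> with
  \<open>s \<noteq> 0\<close> are distinct and run through exactly those \<open>k \<noteq> 0\<close>
  whose punctured line contains \<open>x\<close>. Swapping the sums then counts, for each
  \<open>k\<close>, the points of \<open>E\<close> on its line.\<close>

lemma sum_over_punctured_lines:
  fixes E :: "('a::{field, finite} ^ 'd::finite) set" and F :: "'a ^ 'd \<Rightarrow> real"
  assumes "0 \<notin> E"
  shows "(\<Sum>x\<in>E. \<Sum>s\<in>UNIV - {0}. F (s *s x)) = (\<Sum>k\<in>UNIV - {0}. F k * real (card (E \<inter> punctured_line k)))"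
proof -
  have nz: "x \<noteq> 0" if "x \<in> E" for x
    using assms that by auto
  have cancel: "s = u" if "s *s x = u *s x" "x \<noteq> 0" for s u :: 'a and x :: "'a ^ 'd"
    using that by (simp add: vector_mul_rcancel)
  have "(\<Sum>x\<in>E. \<Sum>s\<in>UNIV - {0}. F (s *s x)) = (\<Sum>x\<in>E. \<Sum>k\<in>{k \<in> UNIV - {0}. x \<in> punctured_line k}. F k)"
  proof (rule sum.cong[OF refl])
    fix x assume "x \<in> E"
    have "bij_betw (\<lambda>s. s *s x) (UNIV - {0}) {k \<in> UNIV - {0}. x \<in> punctured_line k}"
    proof (rule bij_betw_imageI)
      show "inj_on (\<lambda>s. s *s x) (UNIV - {0})"
        using cancel nz[OF \<open>x \<in> E\<close>] by (auto intro: inj_onI)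
      show "(\<lambda>s. s *s x) ` (UNIV - {0}) = {k \<in> UNIV - {0}. x \<in> punctured_line k}"
      proof (intro equalityI subsetI)
        fix k assume "k \<in> (\<lambda>s. s *s x) ` (UNIV - {0})"
        then obtain s where s: "s \<noteq> 0" "k = s *s x"
          by auto
        then have "x = inverse s *s k" "inverse s \<noteq> 0"
          by (simp_all add: vector_smult_assoc)
        then show "k \<in> {k \<in> UNIV - {0}. x \<in> punctured_line k}"
          using nz[OF \<open>x \<in> E\<close>] unfolding punctured_line_def by auto
      next
        fix k assume "k \<in> {k \<in> UNIV - {0}. x \<in> punctured_line k}"
        then obtain s where s: "s \<noteq> 0" "x = s *s k"
          by (auto simp: punctured_line_def)
        then have "k = inverse s *s x" "inverse s \<in> UNIV - {0}"
          by (simp_all add: vector_smult_assoc)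
        then show "k \<in> (\<lambda>s. s *s x) ` (UNIV - {0})"
          by blast
      qed
    qed
    then show "(\<Sum>s\<in>UNIV - {0}. F (s *s x)) = (\<Sum>k\<in>{k \<in> UNIV - {0}. x \<in> punctured_line k}. F k)"
      by (rule sum.reindex_bij_betw)
  qed
  also have "\<dots> = (\<Sum>k\<in>UNIV - {0}. \<Sum>x\<in>{x \<in> E. x \<in> punctured_line k}. F k)"
    by (rule sum.swap_restrict) auto
  also have "\<dots> = (\<Sum>k\<in>UNIV - {0}. F k * real (card (E \<inter> punctured_line k)))"
    by (simp add: Int_def mult.commute)
  finally show ?thesis .
qed

lemma (in character) sum_dot_count_square:
  fixes f g :: "'a ^ 'd::finite \<Rightarrow> real"
  assumes g: "\<And>x. g x \<ge> 0" and E: "0 \<notin> support_on UNIV f"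
  shows "(\<Sum>t\<in>UNIV. (dot_count f g t)\<^sup>2)
    \<le> (l2_norm f)\<^sup>2 * real (card (support_on UNIV f)) * (l1_norm g)\<^sup>2 / real CARD('a)
      + (l2_norm f)\<^sup>2 * real CARD('a) ^ (2 * CARD('d) - 1) *
        (\<Sum>k\<in>UNIV - {0}. (norm (fourier \<psi> (\<lambda>x. complex_of_real (g x)) k))\<^sup>2
          * real (card (support_on UNIV f \<inter> punctured_line k)))"
proof -
  define q where "q = real CARD('a)"
  have q: "q > 0"
    by (simp add: q_def)
  let ?E = "support_on UNIV f"
  define F where "F k = (norm (fourier \<psi> (\<lambda>x. complex_of_real (g x)) k))\<^sup>2" for k
  \<comment> \<open>The coefficient at frequency 0 is the mean of \<open>g\<close>; this is the
    source of the main term.\<close>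
  have F0: "q ^ (2 * CARD('d) - 1) * F 0 = (l1_norm g)\<^sup>2 / q"
  proof -
    have "fourier \<psi> (\<lambda>x. complex_of_real (g x)) 0 = of_real (l1_norm g / q ^ CARD('d))"
      using g by (simp add: fourier_def l1_norm_def q_def scalar_product_def)
    then have "F 0 = (l1_norm g)\<^sup>2 / (q ^ CARD('d))\<^sup>2"
      unfolding F_def by (simp only: norm_of_real power2_abs power_divide)
    moreover have "(q ^ CARD('d))\<^sup>2 = q * q ^ (2 * CARD('d) - 1)"
      using power_Suc[of q "2 * CARD('d) - 1"] by (simp add: power_mult[symmetric] mult.commute)
    ultimately show ?thesis
      using q by simp
  qed
  have "(\<Sum>t\<in>UNIV. (dot_count f g t)\<^sup>2) \<le> (\<Sum>t\<in>UNIV. (l2_norm f)\<^sup>2 * (\<Sum>x\<in>?E. (hyperplane_sum g t x)\<^sup>2))"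
  proof (rule sum_mono)
    fix t
    \<comment> \<open>Applying Cauchy-Schwarz on the support only is what later produces the factor
      \<open>card ?E\<close>.\<close>
    have restrict: "(\<Sum>x\<in>UNIV. f x * h x) = (\<Sum>x\<in>?E. f x * h x)" for h
      by (rule sum.mono_neutral_right) (auto simp: support_on_def)
    have "(dot_count f g t)\<^sup>2 \<le> (\<Sum>x\<in>?E. (f x)\<^sup>2) * (\<Sum>x\<in>?E. (hyperplane_sum g t x)\<^sup>2)"
      unfolding dot_count_eq restrict by (rule Cauchy_Schwarz_ineq_sum)
    also have "(\<Sum>x\<in>?E. (f x)\<^sup>2) = (l2_norm f)\<^sup>2"
      unfolding l2_norm_square using restrict[of f] by (simp add: power2_eq_square)
    finally show "(dot_count f g t)\<^sup>2 \<le> (l2_norm f)\<^sup>2 * (\<Sum>x\<in>?E. (hyperplane_sum g t x)\<^sup>2)" .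
  qed
  also have "\<dots> = (l2_norm f)\<^sup>2 * (\<Sum>x\<in>?E. \<Sum>t\<in>UNIV. (hyperplane_sum g t x)\<^sup>2)"
    by (subst sum.swap) (simp add: sum_distrib_left)
  \<comment> \<open>The term \<open>s = 0\<close> is split off: it equals \<open>F 0\<close> for
    every \<open>x\<close>.\<close>
  also have "\<dots> = (l2_norm f)\<^sup>2 * (\<Sum>x\<in>?E. q ^ (2 * CARD('d) - 1) * (F 0 + (\<Sum>s\<in>UNIV - {0}. F (s *s x))))"
  proof -
    have "(\<Sum>t\<in>UNIV. (hyperplane_sum g t x)\<^sup>2)
      = q ^ (2 * CARD('d) - 1) * (F 0 + (\<Sum>s\<in>UNIV - {0}. F (s *s x)))" for x
      using sum.remove[of UNIV 0 "\<lambda>s. F (s *s x)"] sum_hyperplane_sum_square[of g x]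
      by (simp add: F_def q_def)
    then show ?thesis by simp
  qed
  also have "\<dots> = (l2_norm f)\<^sup>2 * real (card ?E) * (q ^ (2 * CARD('d) - 1) * F 0)
      + (l2_norm f)\<^sup>2 * q ^ (2 * CARD('d) - 1) * (\<Sum>x\<in>?E. \<Sum>s\<in>UNIV - {0}. F (s *s x))"
    by (simp only: sum_distrib_left[symmetric] sum.distrib sum_constant) (simp add: algebra_simps)
  finally show ?thesis
    unfolding F0 sum_over_punctured_lines[OF E] by (simp add: F_def q_def)
qed

theorem theorem2p1:
  fixes f g :: "'a::{field, finite} ^ 'd::finite \<Rightarrow> real"
    and \<psi> :: "'a \<Rightarrow> complex"
  assumes "nontrivial_additive_character \<psi>"
    and "\<And>x. f x \<ge> 0"
    and "\<And>x. g x \<ge> 0"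
  shows "(\<exists>R :: 'a \<Rightarrow> real.
            (\<forall>t. dot_count f g t = l1_norm f * l1_norm g / real CARD('a) + R t) \<and>
            (\<forall>t. t \<noteq> 0 \<longrightarrow>
               \<bar>R t\<bar> \<le> l2_norm f * l2_norm g * real CARD('a) powr ((real CARD('d) - 1) / 2)))
       \<and> (0 \<notin> support_on UNIV f \<longrightarrow>
            (\<Sum>t\<in>UNIV. (dot_count f g t)\<^sup>2)
              \<le> (l2_norm f)\<^sup>2 * real (card (support_on UNIV f)) * (l1_norm g)\<^sup>2 / real CARD('a)
                + (l2_norm f)\<^sup>2 * real CARD('a) ^ (2 * CARD('d) - 1) *
                  (\<Sum>k\<in>UNIV - {0}.
                     (norm (fourier \<psi> (\<lambda>x. complex_of_real (g x)) k))\<^sup>2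
                     * real (card (support_on UNIV f \<inter> punctured_line k))))"
proof -
  interpret character \<psi>
    using assms(1) by unfold_locales
  show ?thesis
    using dot_count_deviation[of f g] sum_dot_count_square[of g f] assms(2,3)
    by (intro conjI exI[of _ "\<lambda>t. dot_count f g t - l1_norm f * l1_norm g / real CARD('a)"]) auto
qed

end
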